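(* Let $\mathbf a:\mathbb R^D\to\mathcal H$ satisfy $\langle\mathbf a(\theta),\mathbf a(\theta')\rangle=e^{-\lambda\|\theta-\theta'\|_p^p}$ with $\lambda>0$, $0<p\le1$. Let $\mathcal S^\star=\{\theta^\star_\ell\}_{\ell=1}^k\subset\mathbb R^D$ be pairwise distinct and $\Delta_0=\min_{d\in\{1,\dots,D\}}\min\{|\theta^\star_\ell[d]-\theta^\star_{\ell'}[d]|:\ \ell,\ell'\in\{1,\dots,k\},\ \theta^\star_\ell[d]\ne\theta^\star_{\ell'}[d]\}$ (with $\min\emptyset=+\infty$). If $\Delta_0^p\ge\log(2k-1)/\lambda$, then for every $\mathcal S\subseteq\mathcal S^\star$, OMP achieves exact $\mathrm{card}(\mathcal S)$-step recovery of $\mathcal S$.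
   Context: $\|\theta\|_p^p=\sum_d|\theta[d]|^p$; $\mathcal H$ real Hilbert space. OMP with input $\mathbf y$: $\mathbf r=\mathbf y$, $\widehat{\mathcal S}=\emptyset$; while $\mathbf r\ne0$: choose any $\widehat\theta_t\in\arg\max_\theta|\langle\mathbf a(\theta),\mathbf r\rangle|$, add it to $\widehat{\mathcal S}$, set $\mathbf r$ to $\mathbf y$ minus its orthogonal projection onto $\mathrm{span}\{\mathbf a(\widehat\theta_1),\dots,\mathbf a(\widehat\theta_t)\}$. A reachable support is any final $\widehat{\mathcal S}$ obtainable through some sequence of choices of maximizers. OMP achieves exact $m$-step recovery of $\mathcal S=\{\vartheta_1,\dots,\vartheta_m\}$ if for all nonzero reals $c_1,\dots,c_m$ every reachable support of OMP with input $\sum_{j}c_j\mathbf a(\vartheta_j)$ equals $\mathcal S$ (trivial for $\mathcal S=\emptyset$). *)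

theory Defs
  imports "HOL-Analysis.Analysis"
begin

definition orth_proj :: "'h::real_inner set \<Rightarrow> 'h \<Rightarrow> 'h" where
  "orth_proj V y = (THE q. q \<in> span V \<and> (\<forall>v\<in>span V. (y - q) \<bullet> v = 0))"

definition omp_resid :: "('t \<Rightarrow> 'h::real_inner) \<Rightarrow> 'h \<Rightarrow> 't list \<Rightarrow> 'h" where
  "omp_resid a y ts = y - orth_proj (a ` set ts) y"

definition is_argmax_corr :: "('t \<Rightarrow> 'h::real_inner) \<Rightarrow> 'h \<Rightarrow> 't \<Rightarrow> bool" where
  "is_argmax_corr a r \<theta> \<longleftrightarrow> (\<forall>\<theta>'. \<bar>a \<theta>' \<bullet> r\<bar> \<le> \<bar>a \<theta> \<bullet> r\<bar>)"

inductive omp_run :: "('t \<Rightarrow> 'h::real_inner) \<Rightarrow> 'h \<Rightarrow> 't list \<Rightarrow> bool" for a y where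
  omp_init: "omp_run a y []"
| omp_step: "omp_run a y ts \<Longrightarrow> omp_resid a y ts \<noteq> 0 \<Longrightarrow>
     is_argmax_corr a (omp_resid a y ts) \<theta> \<Longrightarrow> omp_run a y (ts @ [\<theta>])"

definition omp_reachable_support :: "('t \<Rightarrow> 'h::real_inner) \<Rightarrow> 'h \<Rightarrow> 't set \<Rightarrow> bool" where
  "omp_reachable_support a y S' \<longleftrightarrow>
     (\<exists>ts. omp_run a y ts \<and> omp_resid a y ts = 0 \<and> set ts = S')"

definition omp_exact_recovery :: "('t \<Rightarrow> 'h::real_inner) \<Rightarrow> nat \<Rightarrow> 't set \<Rightarrow> bool" where
  "omp_exact_recovery a m S \<longleftrightarrow> finite S \<and> card S = m \<and>
     (\<forall>c :: 't \<Rightarrow> real. (\<forall>\<theta>\<in>S. c \<theta> \<noteq> 0) \<longrightarrow>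
        (\<forall>S'. omp_reachable_support a (\<Sum>\<theta>\<in>S. c \<theta> *\<^sub>R a \<theta>) S' \<longrightarrow> S' = S))"

definition lp_pow :: "real \<Rightarrow> real ^ 'd \<Rightarrow> real" where
  "lp_pow p x = (\<Sum>d\<in>UNIV. \<bar>x $ d\<bar> powr p)"

text \<open>Minimal nonzero coordinatewise separation (Inf of the empty set is +infinity).\<close>
definition Delta0 :: "(real ^ 'd) set \<Rightarrow> ereal" where
  "Delta0 S = Inf {ereal \<bar>x $ d - y $ d\<bar> | d x y. x \<in> S \<and> y \<in> S \<and> x $ d \<noteq> y $ d}"

end

theory Submission
  imports Defs
begin

text \<open>The residuals of OMP are combinations \<open>r\<close> of the atoms of \<open>S\<close>, so it suffices that \<open>\<theta> \<mapsto> \<bar>a \<theta> \<bullet> r\<bar>\<close> is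
  maximal only on \<open>S\<close>. Along a coordinate direction the correlation is \<open>\<Sum>j. b j * \<phi> (\<bar>t - j\<bar>)\<close> with knots at
  the coordinates of \<open>S\<close> and \<open>\<phi> x = exp (- lam * x powr p)\<close>, which is convex and supermultiplicative.
  Interpolating the kernel function of a point \<open>t\<close> by those of its two neighbouring knots leaves errors at the
  other knots that the separation makes negligible against the loss in the interpolation weights, so
  a maximum can only sit at a knot. Hence a maximizer lies on the Cartesian grid spanned by \<open>S\<close>, where
  distinct points have kernel value at most \<open>\<mu> \<le> 1 / (2 * k - 1)\<close>, and diagonal dominance of the Gram
  matrix excludes the grid points outside \<open>S\<close>.\<close>

section \<open>Convex supermultiplicative kernels on the line\<close>

text \<open>Look at row \<open>k\<close> of a coefficient of largest modulus: the off-diagonal part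
  there is at most \<open>(card K - 1) * \<mu> * |b k|\<close>. \<open>dom\<close> keeps the factor
  nonnegative, so the bound passes from \<open>k\<close> to every \<open>i\<close>.\<close>

lemma diag_dominant_coeff_bound:
  fixes G :: "'i \<Rightarrow> 'i \<Rightarrow> real" and b :: "'i \<Rightarrow> real"
  assumes fin: "finite K"
    and off: "\<And>i j. i \<in> K \<Longrightarrow> j \<in> K \<Longrightarrow> i \<noteq> j \<Longrightarrow> \<bar>G i j\<bar> \<le> \<mu>"
    and diag: "\<And>i. i \<in> K \<Longrightarrow> G i i = 1"
    and dom: "(real (card K) - 1) * \<mu> \<le> 1"
    and H: "\<And>i. i \<in> K \<Longrightarrow> \<bar>\<Sum>j\<in>K. b j * G i j\<bar> \<le> H"
    and i: "i \<in> K"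
  shows "(1 - (real (card K) - 1) * \<mu>) * \<bar>b i\<bar> \<le> H"
proof -
  have "Max ((\<lambda>j. \<bar>b j\<bar>) ` K) \<in> (\<lambda>j. \<bar>b j\<bar>) ` K" using fin i by (intro Max_in) auto
  then obtain k where k: "k \<in> K" "\<bar>b k\<bar> = Max ((\<lambda>j. \<bar>b j\<bar>) ` K)" by auto
  have kmax: "\<bar>b j\<bar> \<le> \<bar>b k\<bar>" if "j \<in> K" for j using k(2) fin that by simp
  have card: "real (card (K - {k})) = real (card K) - 1"
    using card_Suc_Diff1[OF fin k(1)] by linarith
  have "\<bar>\<Sum>j\<in>K-{k}. b j * G k j\<bar> \<le> (\<Sum>j\<in>K-{k}. \<bar>b k\<bar> * \<mu>)"
    by (rule order_trans[OF sum_abs sum_mono])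
       (use kmax off k(1) in \<open>auto simp: abs_mult intro!: mult_mono\<close>)
  also have "\<dots> = (real (card K) - 1) * \<mu> * \<bar>b k\<bar>" using card by simp
  finally have 1: "\<bar>\<Sum>j\<in>K-{k}. b j * G k j\<bar> \<le> (real (card K) - 1) * \<mu> * \<bar>b k\<bar>" .
  have "(\<Sum>j\<in>K. b j * G k j) = b k + (\<Sum>j\<in>K-{k}. b j * G k j)"
    using fin k(1) diag by (simp add: sum.remove)
  with 1 H[OF k(1)] have "(1 - (real (card K) - 1) * \<mu>) * \<bar>b k\<bar> \<le> H"
    by (simp add: algebra_simps)
  moreover have "(1 - (real (card K) - 1) * \<mu>) * \<bar>b i\<bar> \<le> (1 - (real (card K) - 1) * \<mu>) * \<bar>b k\<bar>"
    using kmax[OF i] dom by (intro mult_left_mono) auto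
  ultimately show ?thesis by linarith
qed

text \<open>Collects what is used of \<open>exp (- lam * x powr p)\<close> on a line: convexity
  bounds interpolation errors from above, supermultiplicativity and monotonicity from below.\<close>

locale convex_kernel =
  fixes \<phi> :: "real \<Rightarrow> real"
  assumes at_0: "\<phi> 0 = 1"
    and pos: "\<phi> x > 0"
    and less_1: "x > 0 \<Longrightarrow> \<phi> x < 1"
    and antimono: "0 \<le> x \<Longrightarrow> x \<le> y \<Longrightarrow> \<phi> y \<le> \<phi> x"
    and supermult: "0 \<le> x \<Longrightarrow> 0 \<le> y \<Longrightarrow> \<phi> x * \<phi> y \<le> \<phi> (x + y)"
    and convex: "convex_on {0..} \<phi>"
begin

lemma chord:
  assumes "0 < x" "0 < y" "0 \<le> z"
  shows "\<phi> (z + x) \<le> (1 - x / (x + y)) * \<phi> z + x / (x + y) * \<phi> (z + x + y)"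
proof -
  let ?s = "x / (x + y)"
  have s: "0 \<le> ?s" "?s \<le> 1" using assms by auto
  have "?s * (x + y) = x" using assms by simp
  moreover have "(1 - ?s) *\<^sub>R z + ?s *\<^sub>R (z + x + y) = z + ?s * (x + y)"
    by (simp only: real_scaleR_def) (simp only: algebra_simps)
  ultimately have e: "(1 - ?s) *\<^sub>R z + ?s *\<^sub>R (z + x + y) = z + x" by simp
  show ?thesis
    using convex_onD[OF convex s, of z "z + x + y"] assms unfolding e by auto
qed

text \<open>For \<open>l < t < r\<close> with \<open>x = t - l\<close> and \<open>y = r - t\<close>, the function \<open>\<phi> (\<bar>\<cdot> - t\<bar>)\<close> is interpolated at \<open>l\<close> and \<open>r\<close>
  by \<open>\<beta> * \<phi> (\<bar>\<cdot> - l\<bar>) + \<gamma> * \<phi> (\<bar>\<cdot> - r\<bar>)\<close>. For \<open>\<phi> x = exp (- x)\<close> the interpolation is exact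
  outside \<open>(l, r)\<close>; in general the error at distance \<open>z\<close> is comparable to the gain \<open>1 - (\<beta> + \<gamma>)\<close>.\<close>
lemma interpolation_error:
  assumes x: "0 < x" and y: "0 < y" and z: "0 \<le> z"
    and m: "m = \<phi> (x + y)" "m \<le> 1/3"
    and \<beta>: "\<beta> = (\<phi> x - m * \<phi> y) / (1 - m\<^sup>2)"
    and \<gamma>: "\<gamma> = (\<phi> y - m * \<phi> x) / (1 - m\<^sup>2)"
  shows "\<bar>\<phi> (z + x) - \<beta> * \<phi> z - \<gamma> * \<phi> (z + x + y)\<bar> \<le> \<phi> z * (1 + m - \<phi> x - \<phi> y)"
proof -
  \<comment> \<open>Division by \<open>\<phi> z\<close> reduces the claim to a bound of
    \<open>v - \<beta> - \<gamma> * q\<close> by \<open>Q\<close> in modulus.\<close>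
  define X Y q s v where "X = \<phi> x" and "Y = \<phi> y" and "q = \<phi> (z + x + y) / \<phi> z"
    and "s = x / (x + y)" and "v = \<phi> (z + x) / \<phi> z"
  define Q where "Q = 1 + m - X - Y"
  have m0: "0 < m" using m(1) pos by simp
  have XY: "0 < X" "X < 1" "0 < Y" "Y < 1" "X * Y \<le> m" "m \<le> X" "m \<le> Y"
    using x y less_1 pos supermult[of x y] antimono[of x "x+y"] antimono[of y "x+y"]
    unfolding X_def Y_def m(1) by auto
  have m2: "m\<^sup>2 \<le> 1/9" using power_mono[of m "1/3" 2] m0 m(2) by (simp add: power2_eq_square)
  have den: "1 - m\<^sup>2 \<noteq> 0" using m2 by simp
  have \<beta>1: "\<beta> * (1 - m\<^sup>2) = X - m * Y" and \<gamma>1: "\<gamma> * (1 - m\<^sup>2) = Y - m * X"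
    using den unfolding \<beta> \<gamma> X_def Y_def by simp_all
  \<comment> \<open>\<open>\<beta>\<close> and \<open>\<gamma>\<close> solve the two equations that
    make the interpolation exact at both endpoints.\<close>
  have "(\<beta> + m * \<gamma>) * (1 - m\<^sup>2) = X * (1 - m\<^sup>2)" "(m * \<beta> + \<gamma>) * (1 - m\<^sup>2) = Y * (1 - m\<^sup>2)"
    using \<beta>1 \<gamma>1 by (simp_all add: algebra_simps power2_eq_square) algebra+
  then have bg: "\<beta> + m * \<gamma> = X" "m * \<beta> + \<gamma> = Y" using den by simp_all
  then have Qe: "Q = (1 + m) * (1 - \<beta> - \<gamma>)" unfolding Q_def by (simp add: algebra_simps)
  \<comment> \<open>The two sides differ by \<open>m - X * Y\<close>, which supermultiplicativity
    makes nonnegative.\<close>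
  have Qge: "(1 - X) * (1 - Y) \<le> Q" using XY unfolding Q_def by (simp add: algebra_simps)
  have "0 < (1 - X) * (1 - Y)" using XY by simp
  with Qge have Q0: "0 < Q" by linarith
  have q: "m \<le> q" "q \<le> 1"
    using supermult[of z "x + y"] antimono[of z "z + x + y"] x y z pos[of z] unfolding q_def m(1)
    by (auto simp: field_simps)
  have v: "X \<le> v" "q \<le> v"
    using supermult[of z x] antimono[of "z + x" "z + x + y"] x y z pos[of z]
    unfolding q_def v_def X_def by (auto simp: field_simps)
  have "\<phi> (z + x) / \<phi> z \<le> ((1 - s) * \<phi> z + s * \<phi> (z + x + y)) / \<phi> z"
    using chord[OF x y z] pos[of z] unfolding s_def by (intro divide_right_mono) auto
  then have v3: "v \<le> (1 - s) + s * q"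
    using pos[of z] unfolding v_def q_def by (simp add: add_divide_distrib)
  have s0: "0 \<le> s" "s \<le> 1" using x y unfolding s_def by auto
  \<comment> \<open>The chord bound for \<open>v\<close> leaves an affine function of
    \<open>q\<close> on \<open>[m, 1]\<close>, largest at an endpoint that the sign of the slope
    \<open>s - \<gamma>\<close> selects. At \<open>q = m\<close> a chord bound for \<open>Y\<close>
    finishes.\<close>
  have up: "v - \<beta> - \<gamma> * q \<le> Q"
  proof -
    have Yle: "Y \<le> (1 - (1 - s)) + (1 - s) * m"
    proof -
      have "1 - s = y / (y + x)" using x y unfolding s_def by (simp add: field_simps)
      then show ?thesis using chord[OF y x, of 0] at_0 unfolding Y_def m(1) by (simp add: add.commute)
    qed
    have a: "(1 - s) + s * q - \<beta> - \<gamma> * q = (1 - s - \<beta>) + (s - \<gamma>) * q"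
      by (simp add: algebra_simps)
    show ?thesis
    proof (cases "s \<ge> \<gamma>")
      case True
      then have "(s - \<gamma>) * q \<le> s - \<gamma>" using q mult_left_mono[of q 1 "s - \<gamma>"] by simp
      then have "v - \<beta> - \<gamma> * q \<le> 1 - \<beta> - \<gamma>" using v3 a by linarith
      also have "\<dots> \<le> Q"
      proof -
        have "0 < 1 - \<beta> - \<gamma>" using Q0 m0 unfolding Qe by (simp add: zero_less_mult_iff)
        then show ?thesis unfolding Qe using m0 by (simp add: distrib_right)
      qed
      finally show ?thesis .
    next
      case False
      then have "(s - \<gamma>) * q \<le> (s - \<gamma>) * m" using q by (intro mult_left_mono_neg) auto
      then have "v - \<beta> - \<gamma> * q \<le> (1 - s - \<beta>) + (s - \<gamma>) * m" using v3 a by linarith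
      also have "\<dots> = 1 - s + s * m - X" using bg(1) by (simp add: algebra_simps)
      also have "\<dots> \<le> Q" using Yle unfolding Q_def by (simp add: algebra_simps)
      finally show ?thesis .
    qed
  qed
  \<comment> \<open>As \<open>v\<close> is at least \<open>X\<close> and at least \<open>q\<close>,
    and \<open>\<gamma>\<close> lies in \<open>[0, 1]\<close>, the worst case is
    \<open>q = X\<close>, with value \<open>- (\<gamma> * (X - m))\<close>.\<close>
  have lo: "- Q \<le> v - \<beta> - \<gamma> * q"
  proof -
    have mX: "m * X \<le> Y" using XY m0 mult_left_mono[of X 1 m] by linarith
    have "0 \<le> \<gamma> * (1 - m\<^sup>2)" using mX \<gamma>1 by simp
    then have g0: "0 \<le> \<gamma>" using m2 by (simp add: zero_le_mult_iff)
    have "0 \<le> \<beta> * (1 - m\<^sup>2)" using XY m0 mult_left_mono[of Y 1 m] \<beta>1 by linarith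
    then have b0: "0 \<le> \<beta>" using m2 by (simp add: zero_le_mult_iff)
    then have g1: "\<gamma> \<le> 1" using bg(2) XY m0 mult_nonneg_nonneg[of m \<beta>] by linarith
    have "- (\<gamma> * (X - m)) \<le> v - \<beta> - \<gamma> * q"
    proof (cases "q \<le> X")
      case True
      then have "\<gamma> * q \<le> \<gamma> * X" using g0 by (intro mult_left_mono)
      then show ?thesis using v(1) bg(1) by (simp add: algebra_simps)
    next
      case False
      then have "(1 - \<gamma>) * X \<le> (1 - \<gamma>) * q" using g1 by (intro mult_left_mono) auto
      then show ?thesis using v(2) bg(1) by (simp add: algebra_simps)
    qed
    moreover have "\<gamma> * (X - m) \<le> Q"
    proof -
      \<comment> \<open>Both factors grow when \<open>m\<close> is replaced by the smaller
        \<open>X * Y\<close>, and \<open>(1 - X) * (1 - Y)\<close> then factors out. The constant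
        \<open>2/3\<close> comes from \<open>m \<le> 1/3\<close> and stays below
        \<open>1 - m\<^sup>2\<close>.\<close>
      have "(Y - m * X) * (X - m) \<le> (Y - X * Y * X) * (X - X * Y)"
        using XY mX mult_right_mono[of "X * Y" m X] by (intro mult_mono) (auto simp: mult_le_one)
      also have "\<dots> = (X * Y) * (1 + X) * ((1 - X) * (1 - Y))" by (simp add: algebra_simps)
      also have "\<dots> \<le> 2/3 * ((1 - X) * (1 - Y))"
      proof (rule mult_right_mono)
        have "X * Y * (1 + X) \<le> 1/3 * 2" using XY m(2) by (intro mult_mono) auto
        then show "X * Y * (1 + X) \<le> 2/3" by simp
      qed (use XY in simp)
      also have "\<dots> \<le> 2/3 * Q" using Qge by simp
      also have "\<dots> \<le> (1 - m\<^sup>2) * Q" using m2 Q0 by (intro mult_right_mono) auto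
      finally have "(1 - m\<^sup>2) * (\<gamma> * (X - m)) \<le> (1 - m\<^sup>2) * Q"
        using \<gamma>1 by (simp add: mult.assoc[symmetric] mult.commute[of "1 - m\<^sup>2"])
      then show ?thesis using m2 by (simp add: mult_le_cancel_left)
    qed
    ultimately show ?thesis by linarith
  qed
  have "\<bar>v - \<beta> - \<gamma> * q\<bar> \<le> Q" using up lo by (simp add: abs_le_iff)
  then have "\<phi> z * \<bar>v - \<beta> - \<gamma> * q\<bar> \<le> \<phi> z * Q" using pos[of z] by (intro mult_left_mono) auto
  moreover have "\<phi> z * \<bar>v - \<beta> - \<gamma> * q\<bar> = \<bar>\<phi> z * (v - \<beta> - \<gamma> * q)\<bar>"
    using pos[of z] by (simp add: abs_mult)
  moreover have "\<phi> z * (v - \<beta> - \<gamma> * q) = \<phi> (z + x) - \<beta> * \<phi> z - \<gamma> * \<phi> (z + x + y)"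
    using pos[of z] unfolding v_def q_def by (simp add: field_simps)
  ultimately show ?thesis unfolding Q_def X_def Y_def by simp
qed

text \<open>The interpolating combination contributes at most
  \<open>(\<beta> + \<gamma>) * H\<close>. The errors live on the knots outside \<open>Z\<close>,
  with coefficients bounded by diagonal dominance. The case \<open>l = r\<close> covers
  interpolation at a single knot.\<close>

lemma off_knot_bound:
  assumes fin: "finite K" and dom: "(real (card K) - 1) * \<mu> < 1"
    and off: "\<And>i j. i \<in> K \<Longrightarrow> j \<in> K \<Longrightarrow> i \<noteq> j \<Longrightarrow> \<phi> (\<bar>i - j\<bar>) \<le> \<mu>"
    and H: "\<And>i. i \<in> K \<Longrightarrow> \<bar>\<Sum>j\<in>K. b j * \<phi> (\<bar>i - j\<bar>)\<bar> \<le> H"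
    and lr: "l \<in> K" "r \<in> K" and bg: "\<beta> \<ge> 0" "\<gamma> \<ge> 0"
    and Z: "Z \<subseteq> K" "\<And>j. j \<in> Z \<Longrightarrow> \<phi> (\<bar>t - j\<bar>) = \<beta> * \<phi> (\<bar>l - j\<bar>) + \<gamma> * \<phi> (\<bar>r - j\<bar>)"
    and err: "\<And>j. j \<in> K - Z \<Longrightarrow> \<bar>\<phi> (\<bar>t - j\<bar>) - \<beta> * \<phi> (\<bar>l - j\<bar>) - \<gamma> * \<phi> (\<bar>r - j\<bar>)\<bar> \<le> \<epsilon>"
  shows "\<bar>\<Sum>j\<in>K. b j * \<phi> (\<bar>t - j\<bar>)\<bar>
     \<le> (\<beta> + \<gamma>) * H + H / (1 - (real (card K) - 1) * \<mu>) * ((real (card K) - real (card Z)) * \<epsilon>)"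
proof -
  define M where "M = H / (1 - (real (card K) - 1) * \<mu>)"
  define e where "e j = \<phi> (\<bar>t - j\<bar>) - \<beta> * \<phi> (\<bar>l - j\<bar>) - \<gamma> * \<phi> (\<bar>r - j\<bar>)" for j
  have M: "\<bar>b i\<bar> \<le> M" if "i \<in> K" for i
  proof -
    have "(1 - (real (card K) - 1) * \<mu>) * \<bar>b i\<bar> \<le> H"
      by (rule diag_dominant_coeff_bound[OF fin, of "\<lambda>i j. \<phi> (\<bar>i - j\<bar>)"])
         (use off pos dom H that in \<open>auto simp: at_0 abs_of_pos\<close>)
    then show ?thesis using dom unfolding M_def by (simp add: pos_le_divide_eq mult.commute)
  qed
  have "(\<Sum>j\<in>K. b j * e j) = (\<Sum>j\<in>K - Z. b j * e j)"
    using Z by (intro sum.mono_neutral_right fin) (auto simp: e_def)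
  also have "\<bar>\<dots>\<bar> \<le> (\<Sum>j\<in>K - Z. M * \<epsilon>)"
  proof (rule order_trans[OF sum_abs sum_mono])
    fix j assume j: "j \<in> K - Z"
    then have "0 \<le> M" using M[of j] by auto
    with M[of j] err[OF j] j show "\<bar>b j * e j\<bar> \<le> M * \<epsilon>"
      unfolding e_def abs_mult by (intro mult_mono) auto
  qed
  also have "\<dots> = M * ((real (card K) - real (card Z)) * \<epsilon>)"
    using Z(1) fin by (simp add: card_Diff_subset finite_subset of_nat_diff card_mono)
  finally have 1: "\<bar>\<Sum>j\<in>K. b j * e j\<bar> \<le> M * ((real (card K) - real (card Z)) * \<epsilon>)" .
  let ?h = "\<lambda>i. \<Sum>j\<in>K. b j * \<phi> (\<bar>i - j\<bar>)"
  have "?h t = \<beta> * ?h l + \<gamma> * ?h r + (\<Sum>j\<in>K. b j * e j)"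
    unfolding e_def sum_distrib_left sum.distrib[symmetric]
    by (intro sum.cong) (auto simp: algebra_simps)
  moreover have "\<bar>\<beta> * ?h l\<bar> \<le> \<beta> * H" "\<bar>\<gamma> * ?h r\<bar> \<le> \<gamma> * H"
    using H[OF lr(1)] H[OF lr(2)] bg by (auto simp: abs_mult intro!: mult_left_mono)
  ultimately have "\<bar>?h t\<bar> \<le> \<beta> * H + \<gamma> * H + M * ((real (card K) - real (card Z)) * \<epsilon>)"
    using 1 by linarith
  then show ?thesis unfolding M_def by (simp add: distrib_right)
qed

text \<open>All knots lie on one side of \<open>t\<close>, which the additivity of distances
  expresses for both sides at once. The nearest knot \<open>l\<close> is the only node, with weight
  \<open>X\<close>; each error is at most \<open>\<mu> * (1 - X)\<close>, to be paid by the lost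
  weight \<open>1 - X\<close>.\<close>

lemma off_knot_bound_outside:
  assumes fin: "finite K" and dom: "(2 * real (card K) - 1) * \<mu> \<le> 1" and \<mu>: "0 < \<mu>"
    and off: "\<And>i j. i \<in> K \<Longrightarrow> j \<in> K \<Longrightarrow> i \<noteq> j \<Longrightarrow> \<phi> (\<bar>i - j\<bar>) \<le> \<mu>"
    and H: "\<And>i. i \<in> K \<Longrightarrow> \<bar>\<Sum>j\<in>K. b j * \<phi> (\<bar>i - j\<bar>)\<bar> \<le> H" "0 < H"
    and l: "l \<in> K" "t \<noteq> l" "\<And>j. j \<in> K \<Longrightarrow> \<bar>t - j\<bar> = \<bar>t - l\<bar> + \<bar>l - j\<bar>"
  shows "\<bar>\<Sum>j\<in>K. b j * \<phi> (\<bar>t - j\<bar>)\<bar> < H"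
proof -
  define N where "N = real (card K)"
  define X where "X = \<phi> (\<bar>t - l\<bar>)"
  have X: "0 < X" "X < 1" using pos less_1 l(2) unfolding X_def by auto
  have N: "1 \<le> N" using fin l(1) card_gt_0_iff[of K] unfolding N_def by (auto simp: Suc_leI)
  \<comment> \<open>This is \<open>dom\<close> with one \<open>\<mu>\<close> given up, the source of
    strictness.\<close>
  have d: "(N - 1) * \<mu> + (N - 1) * \<mu> < 1" using dom \<mu> unfolding N_def[symmetric] by (simp add: algebra_simps)
  have "0 \<le> (N - 1) * \<mu>" using N \<mu> by simp
  with d have D: "0 < 1 - (N - 1) * \<mu>" by linarith
  have "\<bar>\<Sum>j\<in>K. b j * \<phi> (\<bar>t - j\<bar>)\<bar>
     \<le> (X + 0) * H + H / (1 - (real (card K) - 1) * \<mu>) * ((real (card K) - real (card {l})) * (\<mu> * (1 - X)))"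
  proof (rule off_knot_bound[OF fin _ off H(1) l(1) l(1)])
    fix j assume j: "j \<in> K - {l}"
    let ?f = "\<phi> (\<bar>l - j\<bar>)"
    have e: "\<phi> (\<bar>t - j\<bar>) = \<phi> (\<bar>l - j\<bar> + \<bar>t - l\<bar>)" using l(3)[of j] j by (simp add: add.commute)
    have 1: "X * ?f \<le> \<phi> (\<bar>t - j\<bar>)" "\<phi> (\<bar>t - j\<bar>) \<le> ?f"
      unfolding e X_def using supermult[of "\<bar>l - j\<bar>" "\<bar>t - l\<bar>"] by (auto simp: mult.commute intro!: antimono)
    have "?f * (1 - X) \<le> \<mu> * (1 - X)" using off[of l j] l(1) j X by (intro mult_right_mono) auto
    then show "\<bar>\<phi> (\<bar>t - j\<bar>) - X * ?f - 0 * ?f\<bar> \<le> \<mu> * (1 - X)" using 1 by (simp add: algebra_simps)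
  qed (use D X l(1) at_0 in \<open>auto simp: N_def X_def\<close>)
  also have "\<dots> = X * H + (H * (1 - X)) * ((N - 1) * \<mu> / (1 - (N - 1) * \<mu>))" unfolding N_def by simp
  also have "\<dots> < X * H + (H * (1 - X)) * 1"
  proof (intro add_strict_left_mono mult_strict_left_mono)
    show "(N - 1) * \<mu> / (1 - (N - 1) * \<mu>) < 1" using D d by (subst divide_less_eq_1_pos) linarith+
  qed (use X H(2) in simp)
  finally show ?thesis by (simp add: algebra_simps)
qed

text \<open>Here \<open>l\<close> and \<open>r\<close> are consecutive knots around
  \<open>t\<close>. Errors elsewhere are at most \<open>\<mu> * Q\<close>, and
  \<open>Q = (1 + m) * (1 - \<beta> - \<gamma>)\<close> compares them with the lost weight. What
  remains is \<open>(N - 2) * \<mu> * (1 + m) < 1 - (N - 1) * \<mu>\<close>.\<close>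

lemma off_knot_bound_inside:
  assumes fin: "finite K" and dom: "(2 * real (card K) - 1) * \<mu> \<le> 1" and \<mu>: "0 < \<mu>"
    and off: "\<And>i j. i \<in> K \<Longrightarrow> j \<in> K \<Longrightarrow> i \<noteq> j \<Longrightarrow> \<phi> (\<bar>i - j\<bar>) \<le> \<mu>"
    and H: "\<And>i. i \<in> K \<Longrightarrow> \<bar>\<Sum>j\<in>K. b j * \<phi> (\<bar>i - j\<bar>)\<bar> \<le> H" "0 < H"
    and lr: "l \<in> K" "r \<in> K" "l < t" "t < r" "\<And>j. j \<in> K \<Longrightarrow> j \<le> l \<or> r \<le> j"
  shows "\<bar>\<Sum>j\<in>K. b j * \<phi> (\<bar>t - j\<bar>)\<bar> < H"
proof -
  define N where "N = real (card K)"
  define x y m where "x = t - l" and "y = r - t" and "m = \<phi> (x + y)"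
  define \<beta> \<gamma> where "\<beta> = (\<phi> x - m * \<phi> y) / (1 - m\<^sup>2)" and "\<gamma> = (\<phi> y - m * \<phi> x) / (1 - m\<^sup>2)"
  define Q where "Q = 1 + m - \<phi> x - \<phi> y"
  have xy: "0 < x" "0 < y" "x + y = r - l" using lr unfolding x_def y_def by auto
  have N: "2 \<le> N"
    using card_mono[OF fin, of "{l, r}"] lr unfolding N_def by simp
  have m0: "0 < m" unfolding m_def by (rule pos)
  have m\<mu>: "m \<le> \<mu>" unfolding m_def xy(3) using off[of r l] lr by auto
  \<comment> \<open>With at least two knots \<open>dom\<close> forces
    \<open>\<mu> \<le> 1/3\<close>, the smallness of \<open>m\<close> that
    \<open>interpolation_error\<close> requires.\<close>
  have "3 * \<mu> \<le> (2 * N - 1) * \<mu>" using N \<mu> by (intro mult_right_mono) auto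
  then have \<mu>3: "\<mu> \<le> 1/3" using dom unfolding N_def by linarith
  then have m3: "m \<le> 1/3" using m\<mu> by linarith
  have XY: "\<phi> x < 1" "\<phi> y < 1" "\<phi> x * \<phi> y \<le> m" "m \<le> \<phi> x" "m \<le> \<phi> y"
    using xy less_1 supermult[of x y] antimono[of x "x+y"] antimono[of y "x+y"] unfolding m_def by auto
  have m2: "m\<^sup>2 < 1" using m0 m3 by (simp add: power_less_one_iff)
  have "0 < (1 - \<phi> x) * (1 - \<phi> y)" using XY by simp
  then have Q0: "0 < Q" using XY unfolding Q_def by (simp add: algebra_simps)
  have "m * \<phi> y \<le> m" "m * \<phi> x \<le> m" using m0 XY by (auto simp: mult_left_le)
  then have bg0: "0 \<le> \<beta>" "0 \<le> \<gamma>" using XY m2 unfolding \<beta>_def \<gamma>_def by auto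
  have \<beta>1: "\<beta> * (1 - m\<^sup>2) = \<phi> x - m * \<phi> y" and \<gamma>1: "\<gamma> * (1 - m\<^sup>2) = \<phi> y - m * \<phi> x"
    using m2 unfolding \<beta>_def \<gamma>_def by simp_all
  have "(\<beta> + m * \<gamma>) * (1 - m\<^sup>2) = \<phi> x * (1 - m\<^sup>2)" "(m * \<beta> + \<gamma>) * (1 - m\<^sup>2) = \<phi> y * (1 - m\<^sup>2)"
    using \<beta>1 \<gamma>1 by (simp_all add: algebra_simps power2_eq_square) algebra+
  then have bg: "\<beta> + m * \<gamma> = \<phi> x" "m * \<beta> + \<gamma> = \<phi> y" using m2 by simp_all
  then have Qe: "Q = (1 + m) * (1 - \<beta> - \<gamma>)" unfolding Q_def by (simp add: algebra_simps)
  have Nm: "(N - 2) * m \<le> 1"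
  proof -
    have "(N - 2) * m \<le> (2 * N - 1) * \<mu>" using N m0 m\<mu> by (intro mult_mono) auto
    then show ?thesis using dom unfolding N_def by linarith
  qed
  \<comment> \<open>Collected on one side, the terms in \<open>\<mu>\<close> are
    \<open>(2 * N - 3) * \<mu> + (N - 2) * m * \<mu>\<close>, at most
    \<open>(2 * N - 2) * \<mu>\<close> and so below 1.\<close>
  have d: "(N - 2) * \<mu> * (1 + m) < 1 - (N - 1) * \<mu>"
  proof -
    have "(N - 2) * m * \<mu> \<le> 1 * \<mu>" using Nm \<mu> by (intro mult_right_mono) auto
    moreover have "(2 * N - 1) * \<mu> \<le> 1" using dom unfolding N_def .
    ultimately show ?thesis using \<mu> by (simp add: algebra_simps)
  qed
  have "0 \<le> (N - 2) * \<mu> * (1 + m)" using N \<mu> m0 by simp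
  with d have D: "0 < 1 - (N - 1) * \<mu>" by linarith
  have "\<bar>\<Sum>j\<in>K. b j * \<phi> (\<bar>t - j\<bar>)\<bar>
     \<le> (\<beta> + \<gamma>) * H + H / (1 - (real (card K) - 1) * \<mu>) * ((real (card K) - real (card {l, r})) * (\<mu> * Q))"
  proof (rule off_knot_bound[OF fin _ off H(1) lr(1,2) bg0])
    fix j assume j: "j \<in> {l, r}"
    show "\<phi> (\<bar>t - j\<bar>) = \<beta> * \<phi> (\<bar>l - j\<bar>) + \<gamma> * \<phi> (\<bar>r - j\<bar>)"
      using j
    proof
      assume "j = l"
      then show ?thesis using lr bg(1) xy(3) at_0 unfolding x_def m_def by (simp add: mult.commute)
    next
      assume "j \<in> {r}"
      then have "\<bar>t - j\<bar> = y" "\<bar>l - j\<bar> = x + y" "\<bar>r - j\<bar> = 0" using lr xy(3) unfolding y_def by auto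
      then show ?thesis using bg(2) at_0 unfolding m_def by (simp add: mult.commute)
    qed
  next
    fix j assume j: "j \<in> K - {l, r}"
    have *: "\<phi> z * Q \<le> \<mu> * Q" if "\<phi> z \<le> \<mu>" for z using that Q0 by (intro mult_right_mono) auto
    from j lr(5)[of j] consider "j < l" | "r < j" by force
    then show "\<bar>\<phi> (\<bar>t - j\<bar>) - \<beta> * \<phi> (\<bar>l - j\<bar>) - \<gamma> * \<phi> (\<bar>r - j\<bar>)\<bar> \<le> \<mu> * Q"
    proof cases
      case 1
      define z where "z = l - j"
      have e: "\<bar>t - j\<bar> = z + x" "\<bar>l - j\<bar> = z" "\<bar>r - j\<bar> = z + x + y"
        using 1 lr unfolding z_def x_def y_def by auto
      have "\<bar>\<phi> (z + x) - \<beta> * \<phi> z - \<gamma> * \<phi> (z + x + y)\<bar> \<le> \<phi> z * Q"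
        unfolding Q_def by (rule interpolation_error[OF xy(1,2) _ m_def m3 \<beta>_def \<gamma>_def]) (use 1 in \<open>simp add: z_def\<close>)
      also have "\<dots> \<le> \<mu> * Q" using off[of l j] j lr e by (intro *) auto
      finally show ?thesis unfolding e .
    next
      \<comment> \<open>Reflected situation: \<open>x\<close> and \<open>y\<close>, and likewise
        \<open>\<beta>\<close> and \<open>\<gamma>\<close>, change places.\<close>
      case 2
      define z where "z = j - r"
      have e: "\<bar>t - j\<bar> = z + y" "\<bar>r - j\<bar> = z" "\<bar>l - j\<bar> = z + y + x"
        using 2 lr unfolding z_def x_def y_def by auto
      have m': "m = \<phi> (y + x)" unfolding m_def by (simp add: add.commute)
      have "\<bar>\<phi> (z + y) - \<gamma> * \<phi> z - \<beta> * \<phi> (z + y + x)\<bar> \<le> \<phi> z * (1 + m - \<phi> y - \<phi> x)"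
        by (rule interpolation_error[OF xy(2,1) _ m' m3 \<gamma>_def \<beta>_def]) (use 2 in \<open>simp add: z_def\<close>)
      also have "\<dots> = \<phi> z * Q" unfolding Q_def by (simp add: algebra_simps)
      also have "\<dots> \<le> \<mu> * Q" using off[of r j] j lr e by (intro *) auto
      finally show ?thesis unfolding e by (simp add: algebra_simps)
    qed
  qed (use D lr in \<open>auto simp: N_def\<close>)
  also have "\<dots> = (\<beta> + \<gamma>) * H + (H * (1 - \<beta> - \<gamma>)) * ((N - 2) * \<mu> * (1 + m) / (1 - (N - 1) * \<mu>))"
    using lr(3,4) unfolding N_def Qe by simp
  also have "\<dots> < (\<beta> + \<gamma>) * H + (H * (1 - \<beta> - \<gamma>)) * 1"
  proof -
    have "0 < 1 - \<beta> - \<gamma>" using Q0 m0 unfolding Qe by (simp add: zero_less_mult_iff)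
    then show ?thesis
      using D d H(2) by (intro add_strict_left_mono mult_strict_left_mono) auto
  qed
  finally show ?thesis by (simp add: algebra_simps)
qed

lemma off_knot_less:
  assumes fin: "finite K" and dom: "(2 * real (card K) - 1) * \<mu> \<le> 1" and \<mu>: "0 < \<mu>"
    and off: "\<And>i j. i \<in> K \<Longrightarrow> j \<in> K \<Longrightarrow> i \<noteq> j \<Longrightarrow> \<phi> (\<bar>i - j\<bar>) \<le> \<mu>"
    and H: "\<And>i. i \<in> K \<Longrightarrow> \<bar>\<Sum>j\<in>K. b j * \<phi> (\<bar>i - j\<bar>)\<bar> \<le> H" "0 < H"
    and t: "t \<notin> K"
  shows "\<bar>\<Sum>j\<in>K. b j * \<phi> (\<bar>t - j\<bar>)\<bar> < H"
proof -
  let ?L = "{j\<in>K. j < t}" and ?R = "{j\<in>K. t < j}"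
  have LR: "j \<in> ?L \<or> j \<in> ?R" if "j \<in> K" for j using that t by (cases "j = t") auto
  have l: "Max ?L \<in> ?L" "\<And>j. j \<in> ?L \<Longrightarrow> j \<le> Max ?L" if "?L \<noteq> {}"
    using Max_in[of ?L] fin that by auto
  have r: "Min ?R \<in> ?R" "\<And>j. j \<in> ?R \<Longrightarrow> Min ?R \<le> j" if "?R \<noteq> {}"
    using Min_in[of ?R] fin that by auto
  consider "K = {}" | "?L \<noteq> {}" "?R \<noteq> {}" | "?L \<noteq> {}" "?R = {}" | "?L = {}" "?R \<noteq> {}"
    using LR by blast
  then show ?thesis
  proof cases
    case 1
    then show ?thesis using H(2) by simp
  next
    case 2
    show ?thesis
      by (rule off_knot_bound_inside[OF fin dom \<mu> off H, of "Max ?L" "Min ?R"])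
         (use l[OF 2(1)] r[OF 2(2)] LR in auto)
  next
    case 3
    show ?thesis
    proof (rule off_knot_bound_outside[OF fin dom \<mu> off H, of "Max ?L"])
      fix j assume "j \<in> K"
      then have "j \<in> ?L" using LR 3(2) by blast
      then show "\<bar>t - j\<bar> = \<bar>t - Max ?L\<bar> + \<bar>Max ?L - j\<bar>" using l[OF 3(1)] by auto
    qed (use l[OF 3(1)] in auto)
  next
    case 4
    show ?thesis
    proof (rule off_knot_bound_outside[OF fin dom \<mu> off H, of "Min ?R"])
      fix j assume "j \<in> K"
      then have "j \<in> ?R" using LR 4(1) by blast
      then show "\<bar>t - j\<bar> = \<bar>t - Min ?R\<bar> + \<bar>Min ?R - j\<bar>" using r[OF 4(2)] by auto
    qed (use r[OF 4(2)] in auto)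
  qed
qed

end

section \<open>Powers with exponent at most 1 and the exponential kernel\<close>

lemma powr_subadd:
  fixes x y p :: real
  assumes "0 < p" "p \<le> 1" "0 \<le> x" "0 \<le> y"
  shows "(x + y) powr p \<le> x powr p + y powr p"
proof (cases "x + y = 0")
  case False
  then have xy: "0 < x + y" using assms by simp
  \<comment> \<open>A fraction in \<open>[0, 1]\<close> does not decrease when raised to
    \<open>p\<close>; the fractions for \<open>x\<close> and \<open>y\<close> add up to 1.\<close>
  have "u / (x + y) \<le> u powr p / (x + y) powr p" if "0 \<le> u" "u \<le> x + y" for u
  proof -
    have "(u / (x + y)) powr 1 \<le> (u / (x + y)) powr p"
      using that xy assms by (intro powr_mono') auto
    then show ?thesis using that xy by (simp add: powr_divide)
  qed
  from this[of x] this[of y] have "x / (x + y) + y / (x + y) \<le> x powr p / (x + y) powr p + y powr p / (x + y) powr p"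
    using assms by auto
  also have "x / (x + y) + y / (x + y) = 1" using xy by (simp flip: add_divide_distrib)
  finally show ?thesis using xy by (simp add: field_simps)
qed (use assms in auto)

lemma powr_concave:
  fixes p :: real
  assumes p: "0 < p" "p \<le> 1"
  shows "concave_on {0..} (\<lambda>x. x powr p)"
  unfolding concave_on_def
proof (rule convex_onI)
  fix t x y :: real
  assume t: "0 < t" "t < 1" and xy: "x \<in> {0..}" "y \<in> {0..}"
  define c where "c = (1 - t) * x + t * y"
  show "- (((1 - t) *\<^sub>R x + t *\<^sub>R y) powr p) \<le> (1 - t) * - (x powr p) + t * - (y powr p)"
  proof (cases "c = 0")
    case True
    have "0 \<le> (1 - t) * x" "0 \<le> t * y" using t xy by auto
    then have "(1 - t) * x = 0" "t * y = 0" using True unfolding c_def by linarith+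
    then show ?thesis using t by simp
  next
    case False
    then have c: "0 < c" using t xy unfolding c_def by (simp add: order_less_le)
    \<comment> \<open>The tangent of \<open>u powr p\<close> at \<open>c\<close>, multiplied by
      \<open>c powr (1 - p)\<close>, is an instance of Young's inequality. Averaging over
      \<open>x\<close> and \<open>y\<close> gives concavity.\<close>
    have tangent: "u powr p * c powr (1 - p) \<le> p * u + (1 - p) * c" if "0 \<le> u" for u
      using Youngs_inequality_0[of p "1 - p" u c] that p c by (cases "u = 0") auto
    have "((1 - t) * x powr p + t * y powr p) * c powr (1 - p)
        = (1 - t) * (x powr p * c powr (1 - p)) + t * (y powr p * c powr (1 - p))"
      by (simp add: algebra_simps)
    also have "\<dots> \<le> (1 - t) * (p * x + (1 - p) * c) + t * (p * y + (1 - p) * c)"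
      using t xy tangent by (intro add_mono mult_left_mono) auto
    also have "\<dots> = p * c + (1 - p) * c" unfolding c_def by (simp add: algebra_simps)
    also have "\<dots> = c powr p * c powr (1 - p)" using c by (simp add: algebra_simps flip: powr_add)
    finally have "(1 - t) * x powr p + t * y powr p \<le> c powr p" using c by simp
    then show ?thesis unfolding c_def by simp
  qed
qed (rule convex_real_interval)

text \<open>Under \<open>exp (- lam * _)\<close>, subadditivity of the power turns into
  supermultiplicativity and concavity into convexity.\<close>

lemma convex_kernel_exp_powr:
  fixes lam p :: real
  assumes lam: "0 < lam" and p: "0 < p" "p \<le> 1"
  shows "convex_kernel (\<lambda>x. exp (- lam * x powr p))"
proof
  fix x y :: real
  show "exp (- lam * x powr p) < 1" if "0 < x" using that lam by simp
  show "exp (- lam * y powr p) \<le> exp (- lam * x powr p)" if "0 \<le> x" "x \<le> y"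
    using that lam p by (simp add: powr_mono2)
  show "exp (- lam * x powr p) * exp (- lam * y powr p) \<le> exp (- lam * (x + y) powr p)"
    if "0 \<le> x" "0 \<le> y"
    using mult_left_mono[OF powr_subadd[OF p that], of lam] lam
    by (simp add: algebra_simps flip: exp_add)
next
  show "convex_on {0..} (\<lambda>x. exp (- lam * x powr p))"
  proof (rule convex_onI)
    fix t x y :: real
    assume t: "0 < t" "t < 1" and xy: "x \<in> {0..}" "y \<in> {0..}"
    let ?z = "(1 - t) *\<^sub>R x + t *\<^sub>R y"
    have "(1 - t) * x powr p + t * y powr p \<le> ?z powr p"
      using concave_onD[OF powr_concave[OF p], of t x y] t xy by simp
    then have "- lam * ?z powr p \<le> - lam * ((1 - t) * x powr p + t * y powr p)"
      using lam by simp
    then have "exp (- lam * ?z powr p) \<le> exp ((1 - t) *\<^sub>R (- lam * x powr p) + t *\<^sub>R (- lam * y powr p))"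
      by (simp add: algebra_simps)
    also have "\<dots> \<le> (1 - t) * exp (- lam * x powr p) + t * exp (- lam * y powr p)"
      using t by (intro convex_onD[OF exp_convex]) auto
    finally show "exp (- lam * ?z powr p) \<le> \<dots>" .
  qed (rule convex_real_interval)
qed auto

section \<open>Location of the maximal correlation\<close>

text \<open>For a largest coefficient \<open>b k\<close> the left side is at most
  \<open>N * \<mu> * |b k|\<close>, while diagonal dominance gives
  \<open>(1 - (N - 1) * \<mu>) * |b k| \<le> H\<close>; \<open>dom\<close> orders these two factors.
  This later excludes grid points outside the support.\<close>

lemma low_correlation_less:
  fixes G :: "'i \<Rightarrow> 'i \<Rightarrow> real" and b g :: "'i \<Rightarrow> real"
  assumes fin: "finite S" and dom: "(2 * real (card S) - 1) * \<mu> \<le> 1" and \<mu>: "0 < \<mu>" "\<mu> < 1"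
    and G: "\<And>i j. i \<in> S \<Longrightarrow> j \<in> S \<Longrightarrow> i \<noteq> j \<Longrightarrow> 0 \<le> G i j \<and> G i j \<le> \<mu>"
      "\<And>i. i \<in> S \<Longrightarrow> G i i = 1"
    and g: "\<And>j. j \<in> S \<Longrightarrow> 0 \<le> g j \<and> g j \<le> \<mu>"
    and H: "\<And>i. i \<in> S \<Longrightarrow> \<bar>\<Sum>j\<in>S. b j * G i j\<bar> \<le> H"
    and nz: "\<exists>i\<in>S. b i \<noteq> 0"
  shows "\<bar>\<Sum>j\<in>S. b j * g j\<bar> < H"
proof -
  define N where "N = real (card S)"
  have "S \<noteq> {}" using nz by auto
  then have "Max ((\<lambda>j. \<bar>b j\<bar>) ` S) \<in> (\<lambda>j. \<bar>b j\<bar>) ` S" using fin by (intro Max_in) auto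
  then obtain k where k: "k \<in> S" "\<bar>b k\<bar> = Max ((\<lambda>j. \<bar>b j\<bar>) ` S)" by auto
  have kmax: "\<bar>b j\<bar> \<le> \<bar>b k\<bar>" if "j \<in> S" for j using k(2) fin that by simp
  have M0: "0 < \<bar>b k\<bar>" using nz kmax by fastforce
  have N1: "1 \<le> N" using fin k(1) unfolding N_def by (cases "card S") auto
  have d: "N * \<mu> \<le> 1 - (N - 1) * \<mu>" using dom unfolding N_def by (simp add: algebra_simps)
  have N\<mu>: "N * \<mu> < 1"
  proof (cases "N = 1")
    case False
    then have "0 < (N - 1) * \<mu>" using N1 \<mu> by simp
    then show ?thesis using d by linarith
  qed (use \<mu> in simp)
  have "(1 - (real (card S) - 1) * \<mu>) * \<bar>b k\<bar> \<le> H"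
  proof (rule diag_dominant_coeff_bound[OF fin _ G(2) _ H k(1)])
    show "(real (card S) - 1) * \<mu> \<le> 1" using d N1 \<mu> unfolding N_def
      by (smt (verit) mult_nonneg_nonneg of_nat_0_le_iff)
  qed (use G(1) in auto)
  then have "N * \<mu> * \<bar>b k\<bar> \<le> H"
    using d M0 mult_right_mono[OF d, of "\<bar>b k\<bar>"] unfolding N_def by linarith
  then have low: "(N - 1) * \<mu> * \<bar>b k\<bar> < H" using \<mu> M0 by (simp add: algebra_simps) (smt (verit) mult_pos_pos)
  \<comment> \<open>Equality \<open>N * \<mu> = 1 - (N - 1) * \<mu>\<close> is allowed, so strictness needs the signs of \<open>b\<close>:
    one summand of the wrong sign lowers the sum, while equal signs raise the correlations inside \<open>S\<close>.\<close>
  have mixed: "(\<Sum>j\<in>S. b' j * g j) \<le> (N - 1) * \<mu> * \<bar>b k\<bar>"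
    if b': "\<And>j. j \<in> S \<Longrightarrow> b' j \<le> \<bar>b k\<bar>" and i: "i \<in> S" "b' i \<le> 0" for b' i
  proof -
    have "(\<Sum>j\<in>S. b' j * g j) = b' i * g i + (\<Sum>j\<in>S-{i}. b' j * g j)"
      using fin i by (simp add: sum.remove)
    also have "b' i * g i \<le> 0" using i g by (simp add: mult_nonpos_nonneg)
    also have "(\<Sum>j\<in>S-{i}. b' j * g j) \<le> (\<Sum>j\<in>S-{i}. \<bar>b k\<bar> * \<mu>)"
    proof (rule sum_mono)
      fix j assume j: "j \<in> S - {i}"
      then have "b' j * g j \<le> \<bar>b k\<bar> * g j" using b' g by (intro mult_right_mono) auto
      also have "\<dots> \<le> \<bar>b k\<bar> * \<mu>" using j g by (intro mult_left_mono) auto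
      finally show "b' j * g j \<le> \<bar>b k\<bar> * \<mu>" .
    qed
    also have "\<dots> = (N - 1) * \<mu> * \<bar>b k\<bar>"
    proof -
      have "real (card (S - {i})) = N - 1" using card_Suc_Diff1[OF fin i(1)] unfolding N_def by linarith
      then show ?thesis by simp
    qed
    finally show ?thesis by simp
  qed
  have same: "\<bar>\<Sum>j\<in>S. b' j * g j\<bar> < (\<Sum>j\<in>S. b' j * G k j)"
    if b': "\<And>j. j \<in> S \<Longrightarrow> 0 < b' j \<and> b' j \<le> \<bar>b k\<bar>" "b' k = \<bar>b k\<bar>" for b'
  proof -
    have nn: "0 \<le> b' j * g j" if "j \<in> S" for j using b'(1)[OF that] g[OF that] by simp
    have "\<bar>\<Sum>j\<in>S. b' j * g j\<bar> = (\<Sum>j\<in>S. b' j * g j)" using nn by (simp add: sum_nonneg)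
    also have "\<dots> \<le> (\<Sum>j\<in>S. \<bar>b k\<bar> * \<mu>)"
      using b' g by (intro sum_mono mult_mono) (auto simp: less_imp_le)
    also have "\<dots> = N * \<mu> * \<bar>b k\<bar>" unfolding N_def by simp
    also have "\<dots> < \<bar>b k\<bar>" using N\<mu> M0 by simp
    also have "\<dots> = b' k * G k k" using b'(2) G(2)[OF k(1)] by simp
    also have "\<dots> \<le> (\<Sum>j\<in>S. b' j * G k j)"
    proof (rule member_le_sum[OF k(1) _ fin])
      fix j assume j: "j \<in> S - {k}"
      then show "0 \<le> b' j * G k j" using b'(1)[of j] G(1)[of k j] k(1) by auto
    qed
    finally show ?thesis .
  qed
  \<comment> \<open>In the last case \<open>i\<close> and \<open>i'\<close> may coincide at a zero
    coefficient; \<open>i\<close> serves to bound the sum, \<open>i'\<close> its negative.\<close>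
  consider "\<And>j. j \<in> S \<Longrightarrow> 0 < b j" | "\<And>j. j \<in> S \<Longrightarrow> b j < 0"
    | i i' where "i \<in> S" "b i \<le> 0" "i' \<in> S" "0 \<le> b i'"
    by (meson not_le)
  then show ?thesis
  proof cases
    case 1
    then have "\<bar>\<Sum>j\<in>S. b j * g j\<bar> < (\<Sum>j\<in>S. b j * G k j)"
      using kmax k(1) by (intro same) (auto simp: abs_le_iff less_imp_le)
    then show ?thesis using H[OF k(1)] by linarith
  next
    case 2
    then have "\<bar>\<Sum>j\<in>S. - b j * g j\<bar> < (\<Sum>j\<in>S. - b j * G k j)"
      using kmax k(1) by (intro same[of "\<lambda>j. - b j"]) (auto simp: abs_le_iff less_imp_le)
    then show ?thesis using H[OF k(1)] by (simp add: sum_negf)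
  next
    case 3
    have "(\<Sum>j\<in>S. b j * g j) \<le> (N - 1) * \<mu> * \<bar>b k\<bar>"
      using kmax 3 by (intro mixed[of b i]) (auto simp: abs_le_iff)
    moreover have "(\<Sum>j\<in>S. - b j * g j) \<le> (N - 1) * \<mu> * \<bar>b k\<bar>"
      using kmax 3 by (intro mixed[of "\<lambda>j. - b j" i']) (auto simp: abs_le_iff)
    ultimately show ?thesis using low by (simp add: sum_negf)
  qed
qed

text \<open>The real \<open>\<Delta>\<close> stands in for \<open>Delta0\<close>, which may be
  infinite; as a mere lower bound of the gaps it can be kept for subsets.\<close>

locale separated_support =
  fixes a :: "real ^ 'd \<Rightarrow> 'h :: real_inner" and lam p \<Delta> :: real and S :: "(real ^ 'd) set"
  assumes kernel: "\<And>\<theta> \<theta>'. a \<theta> \<bullet> a \<theta>' = exp (- lam * lp_pow p (\<theta> - \<theta>'))"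
    and lam_pos: "0 < lam" and p: "0 < p" "p \<le> 1"
    and fin: "finite S" and \<Delta>_pos: "0 < \<Delta>"
    and sep: "\<And>d x y. x \<in> S \<Longrightarrow> y \<in> S \<Longrightarrow> x $ d \<noteq> y $ d \<Longrightarrow> \<Delta> \<le> \<bar>x $ d - y $ d\<bar>"
    and dom: "(2 * real (card S) - 1) * exp (- lam * \<Delta> powr p) \<le> 1"
begin

definition \<mu> :: real where "\<mu> = exp (- lam * \<Delta> powr p)"

lemma \<mu>: "0 < \<mu>" "\<mu> < 1" "(2 * real (card S) - 1) * \<mu> \<le> 1"
  using lam_pos \<Delta>_pos dom unfolding \<mu>_def by auto

lemma inner_self: "a \<theta> \<bullet> a \<theta> = 1"
  unfolding kernel lp_pow_def by simp

lemma inner_le: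
  assumes "\<Delta> \<le> \<bar>x $ d - y $ d\<bar>"
  shows "a x \<bullet> a y \<le> \<mu>"
proof -
  have "\<Delta> powr p \<le> \<bar>(x - y) $ d\<bar> powr p" using assms \<Delta>_pos p by (intro powr_mono2) auto
  also have "\<dots> \<le> lp_pow p (x - y)" unfolding lp_pow_def by (rule member_le_sum) auto
  finally show ?thesis using lam_pos unfolding kernel \<mu>_def by simp
qed

lemma inner_off_diag:
  assumes "x \<in> S" "y \<in> S" "x \<noteq> y"
  shows "0 \<le> a x \<bullet> a y \<and> a x \<bullet> a y \<le> \<mu>"
proof -
  obtain d where "x $ d \<noteq> y $ d" using assms(3) by (auto simp: vec_eq_iff)
  then have "a x \<bullet> a y \<le> \<mu>" using assms sep by (intro inner_le) auto
  then show ?thesis unfolding kernel by simp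
qed

text \<open>Diagonal dominance of the Gram matrix with \<open>H = 0\<close>, since a vanishing
  combination has zero correlations.\<close>

lemma independent_atoms:
  assumes z: "(\<Sum>j\<in>S. b j *\<^sub>R a j) = 0" and i: "i \<in> S"
  shows "b i = 0"
proof -
  have N: "1 \<le> real (card S)" using fin i by (cases "card S") auto
  have "(real (card S) - 1) * \<mu> \<le> (2 * real (card S) - 1) * \<mu> - \<mu>"
    using N \<mu>(1) mult_right_mono[of 1 "real (card S)" \<mu>] by (simp add: algebra_simps)
  then have D: "(real (card S) - 1) * \<mu> < 1" using \<mu>(1,3) by linarith
  have "(1 - (real (card S) - 1) * \<mu>) * \<bar>b i\<bar> \<le> 0"
  proof (rule diag_dominant_coeff_bound[OF fin _ inner_self _ _ i])
    fix k
    have "(\<Sum>j\<in>S. b j * (a k \<bullet> a j)) = a k \<bullet> (\<Sum>j\<in>S. b j *\<^sub>R a j)" by (simp add: inner_sum_right)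
    then show "\<bar>\<Sum>j\<in>S. b j * (a k \<bullet> a j)\<bar> \<le> 0" using z by simp
  qed (use D inner_off_diag in auto)
  then show ?thesis using D by (simp add: mult_le_0_iff)
qed

text \<open>Moving only coordinate \<open>d\<close> of \<open>\<theta>\<close> cannot raise the
  correlation. As \<open>lp_pow\<close> sums over coordinates, the kernel is a product, so on this
  line the correlation is a one-dimensional kernel sum and \<open>off_knot_less\<close>
  applies.\<close>

lemma argmax_on_grid:
  assumes r: "r = (\<Sum>j\<in>S. c j *\<^sub>R a j)" and max: "is_argmax_corr a r \<theta>" and nz: "a \<theta> \<bullet> r \<noteq> 0"
  shows "\<exists>j\<in>S. \<theta> $ d = j $ d"
proof (rule ccontr)
  assume contra: "\<not> ?thesis"
  interpret convex_kernel "\<lambda>x. exp (- lam * x powr p)"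
    using convex_kernel_exp_powr lam_pos p by blast
  define \<psi> where "\<psi> x = exp (- lam * x powr p)" for x
  define K where "K = (\<lambda>j. j $ d) ` S"
  define upd where "upd s = (\<chi> i. if i = d then s else \<theta> $ i)" for s
  \<comment> \<open>\<open>w\<close> absorbs the factors of the fixed coordinates; \<open>b\<close>
    merges the points of \<open>S\<close> that share a knot.\<close>
  define w where "w j = c j * exp (- lam * (\<Sum>i\<in>UNIV - {d}. \<bar>\<theta> $ i - j $ i\<bar> powr p))" for j
  define b where "b t = (\<Sum>j\<in>{j\<in>S. j $ d = t}. w j)" for t
  have lp: "lp_pow p (upd s - j) = \<bar>s - j $ d\<bar> powr p + (\<Sum>i\<in>UNIV - {d}. \<bar>\<theta> $ i - j $ i\<bar> powr p)" for s j
    unfolding lp_pow_def upd_def by (subst sum.remove[of _ d]) auto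
  have line: "a (upd s) \<bullet> r = (\<Sum>t\<in>K. b t * exp (- lam * \<bar>s - t\<bar> powr p))" for s
  proof -
    have "a (upd s) \<bullet> r = (\<Sum>j\<in>S. w j * \<psi> \<bar>s - j $ d\<bar>)"
      unfolding r inner_sum_right inner_scaleR_right kernel lp w_def \<psi>_def
      by (simp only: distrib_left exp_add ac_simps)
    also have "\<dots> = (\<Sum>t\<in>K. \<Sum>j\<in>{j\<in>S. j $ d = t}. w j * \<psi> \<bar>s - j $ d\<bar>)"
      unfolding K_def by (rule sum.image_gen[OF fin])
    also have "\<dots> = (\<Sum>t\<in>K. b t * \<psi> \<bar>s - t\<bar>)"
      unfolding b_def sum_distrib_right by (intro sum.cong) auto
    finally show ?thesis unfolding \<psi>_def .
  qed
  have id: "upd (\<theta> $ d) = \<theta>" unfolding upd_def by (simp add: vec_eq_iff)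
  \<comment> \<open>The correlation at \<open>\<theta>\<close> itself serves as \<open>H\<close>:
    maximality bounds the knots by it, \<open>nz\<close> makes it positive, and being strictly below
    itself is absurd.\<close>
  have "\<bar>\<Sum>t\<in>K. b t * exp (- lam * \<bar>\<theta> $ d - t\<bar> powr p)\<bar> < \<bar>a \<theta> \<bullet> r\<bar>"
  proof (rule off_knot_less[of K \<mu>])
    show "finite K" unfolding K_def using fin by simp
    have "real (card K) \<le> real (card S)" unfolding K_def using fin by (simp add: card_image_le)
    then have "(2 * real (card K) - 1) * \<mu> \<le> (2 * real (card S) - 1) * \<mu>"
      using \<mu>(1) by (intro mult_right_mono) auto
    then show "(2 * real (card K) - 1) * \<mu> \<le> 1" using \<mu>(3) by linarith
    show "0 < \<mu>" by (rule \<mu>)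
    show "exp (- lam * \<bar>i - j\<bar> powr p) \<le> \<mu>" if ij: "i \<in> K" "j \<in> K" "i \<noteq> j" for i j
    proof -
      have "\<Delta> \<le> \<bar>i - j\<bar>" using ij sep unfolding K_def by auto
      then show ?thesis using \<Delta>_pos unfolding \<mu>_def by (intro antimono) auto
    qed
    show "\<bar>\<Sum>j\<in>K. b j * exp (- lam * \<bar>i - j\<bar> powr p)\<bar> \<le> \<bar>a \<theta> \<bullet> r\<bar>" for i
      using max unfolding line[symmetric] is_argmax_corr_def by blast
    show "\<theta> $ d \<notin> K" using contra unfolding K_def by auto
  qed (use nz in simp)
  then show False unfolding line[symmetric] id by simp
qed

text \<open>If \<open>\<theta>\<close> is outside \<open>S\<close>, it differs from each
  \<open>j\<close> in \<open>S\<close> in some coordinate, where it agrees with another point of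
  \<open>S\<close>; the gap is thus at least \<open>\<Delta>\<close>. All kernel values are then at
  most \<open>\<mu>\<close>, and \<open>low_correlation_less\<close> contradicts maximality.\<close>

lemma argmax_in_support:
  assumes r: "r = (\<Sum>j\<in>S. c j *\<^sub>R a j)" and r0: "r \<noteq> 0" and max: "is_argmax_corr a r \<theta>"
  shows "\<theta> \<in> S"
proof (rule ccontr)
  assume \<theta>: "\<theta> \<notin> S"
  have corr: "a \<theta>' \<bullet> r = (\<Sum>j\<in>S. c j * (a \<theta>' \<bullet> a j))" for \<theta>'
    unfolding r by (simp add: inner_sum_right)
  \<comment> \<open>A zero maximum would make \<open>r\<close> orthogonal to every atom, hence to
    itself.\<close>
  have nz: "a \<theta> \<bullet> r \<noteq> 0"
  proof
    assume "a \<theta> \<bullet> r = 0"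
    then have "a j \<bullet> r = 0" for j using max unfolding is_argmax_corr_def by simp
    then have "r \<bullet> r = 0" by (subst r) (simp add: inner_sum_left)
    then show False using r0 by simp
  qed
  have "\<bar>\<Sum>j\<in>S. c j * (a \<theta> \<bullet> a j)\<bar> < \<bar>a \<theta> \<bullet> r\<bar>"
  proof (rule low_correlation_less[OF fin \<mu>(3,1,2) inner_off_diag inner_self])
    fix j assume j: "j \<in> S"
    then have "\<theta> \<noteq> j" using \<theta> by auto
    then obtain d where d: "\<theta> $ d \<noteq> j $ d" by (auto simp: vec_eq_iff)
    obtain i where "i \<in> S" "\<theta> $ d = i $ d" using argmax_on_grid[OF r max nz] by blast
    then have "a \<theta> \<bullet> a j \<le> \<mu>" using sep[of i j d] j d by (intro inner_le[of \<theta> d]) auto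
    then show "0 \<le> a \<theta> \<bullet> a j \<and> a \<theta> \<bullet> a j \<le> \<mu>" unfolding kernel by simp
  next
    show "\<exists>i\<in>S. c i \<noteq> 0" using r r0 by (metis (no_types, lifting) scaleR_eq_0_iff sum.neutral)
  qed (use max in \<open>auto simp: is_argmax_corr_def corr[symmetric]\<close>)
  then show False by (simp add: corr)
qed

end

section \<open>Orthogonal matching pursuit\<close>

text \<open>A Gram-Schmidt step: \<open>e\<close>, the part of the new vector orthogonal to
  \<open>span V\<close>, receives its own coefficient. The induction hypothesis serves both
  \<open>y\<close> and \<open>v\<close>.\<close>

lemma orth_proj_exists:
  fixes y :: "'h :: real_inner"
  assumes "finite V"
  shows "\<exists>q\<in>span V. \<forall>v\<in>span V. (y - q) \<bullet> v = 0"
  using assms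
proof (induction V arbitrary: y)
  case (insert v V)
  obtain q where q: "q \<in> span V" "\<forall>u\<in>span V. (y - q) \<bullet> u = 0" using insert.IH by blast
  obtain s where s: "s \<in> span V" "\<forall>u\<in>span V. (v - s) \<bullet> u = 0" using insert.IH by blast
  define e t where "e = v - s" and "t = (y - q) \<bullet> e / (e \<bullet> e)"
  \<comment> \<open>For \<open>e = 0\<close> division by zero yields \<open>t = 0\<close>, and the
    equation persists.\<close>
  have te: "t * (e \<bullet> e) = (y - q) \<bullet> e" unfolding t_def by (cases "e = 0") auto
  have "e \<in> span (insert v V)"
    unfolding e_def using s(1) by (meson in_mono insertI1 span_base span_diff span_mono subset_insertI)
  moreover have "q \<in> span (insert v V)" using q(1) span_mono[of V "insert v V"] by auto
  ultimately have "q + t *\<^sub>R e \<in> span (insert v V)" by (intro span_add span_scale)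
  moreover have "(y - (q + t *\<^sub>R e)) \<bullet> u = 0" if u: "u \<in> span (insert v V)" for u
  proof -
    obtain k where "u - k *\<^sub>R v \<in> span V" using u span_breakdown_eq by blast
    then have k: "u - k *\<^sub>R e \<in> span V"
      unfolding e_def using span_add[OF _ span_scale[OF s(1), of k], of "u - k *\<^sub>R v"]
      by (simp add: algebra_simps)
    have 1: "(y - q) \<bullet> u = k * ((y - q) \<bullet> e)" using q(2) k by (auto simp: inner_diff_right)
    have 2: "e \<bullet> u = k * (e \<bullet> e)" using s(2) k unfolding e_def[symmetric] by (auto simp: inner_diff_right)
    have "(y - (q + t *\<^sub>R e)) \<bullet> u = (y - q) \<bullet> u - t * (e \<bullet> u)" by (simp add: algebra_simps)
    also have "\<dots> = 0" unfolding 1 2 te[symmetric] by simp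
    finally show ?thesis .
  qed
  ultimately show ?case by blast
qed simp

text \<open>Uniqueness justifies the \<open>THE\<close> of \<open>orth_proj\<close>: two candidates
  differ by a vector of the span that is orthogonal to itself.\<close>

lemma orth_proj_in_span:
  fixes y :: "'h :: real_inner"
  assumes "finite V"
  shows "orth_proj V y \<in> span V"
proof -
  obtain q where q: "q \<in> span V" "\<forall>v\<in>span V. (y - q) \<bullet> v = 0" using orth_proj_exists[OF assms] by blast
  have "orth_proj V y = q"
    unfolding orth_proj_def
  proof (rule the_equality)
    fix q' assume q': "q' \<in> span V \<and> (\<forall>v\<in>span V. (y - q') \<bullet> v = 0)"
    then have d: "q' - q \<in> span V" using q(1) by (intro span_diff) auto
    have "(y - q) \<bullet> (q' - q) = 0" "(y - q') \<bullet> (q' - q) = 0" using q(2) q' d by auto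
    then have "(q' - q) \<bullet> (q' - q) = 0" by (simp add: inner_diff_left)
    then show "q' = q" by simp
  qed (use q in auto)
  then show ?thesis using q(1) by simp
qed

lemma span_image_sum:
  fixes a :: "'t \<Rightarrow> 'h :: real_vector"
  assumes "finite S" "x \<in> span (a ` S)"
  shows "\<exists>b. x = (\<Sum>j\<in>S. b j *\<^sub>R a j)"
  using assms
proof (induction S arbitrary: x)
  case (insert s S)
  then obtain k where "x - k *\<^sub>R a s \<in> span (a ` S)" using span_breakdown_eq[of x "a s"] by auto
  then obtain b where b: "x - k *\<^sub>R a s = (\<Sum>j\<in>S. b j *\<^sub>R a j)" using insert.IH by blast
  have "(\<Sum>j\<in>S. (b(s := k)) j *\<^sub>R a j) = (\<Sum>j\<in>S. b j *\<^sub>R a j)"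
    using insert.hyps by (intro sum.cong) auto
  then have "x = (\<Sum>j\<in>insert s S. (b(s := k)) j *\<^sub>R a j)"
    using insert.hyps by (simp flip: b)
  then show ?case by blast
qed simp

context separated_support
begin

text \<open>While the selection stays in \<open>S\<close>, the residual is a combination of atoms of
  \<open>S\<close>, nonzero by the loop guard, so the next maximizer lies in \<open>S\<close>
  too.\<close>

lemma omp_run_subset:
  assumes "omp_run a y ts" and y: "y \<in> span (a ` S)"
  shows "set ts \<subseteq> S"
  using assms(1)
proof induction
  case (omp_step ts \<theta>)
  have "orth_proj (a ` set ts) y \<in> span (a ` S)"
    using orth_proj_in_span[of "a ` set ts" y] span_mono[of "a ` set ts" "a ` S"] omp_step.IH by auto
  then have "omp_resid a y ts \<in> span (a ` S)" unfolding omp_resid_def using y by (intro span_diff)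
  then obtain b where "omp_resid a y ts = (\<Sum>j\<in>S. b j *\<^sub>R a j)" using span_image_sum[OF fin] by blast
  then have "\<theta> \<in> S" using omp_step.hyps by (intro argmax_in_support)
  then show ?case using omp_step.IH by simp
qed simp

text \<open>A zero residual puts \<open>y\<close> into the span of the selected atoms; independence
  forbids that an atom with nonzero coefficient is missing.\<close>

lemma exact_recovery: "omp_exact_recovery a (card S) S"
  unfolding omp_exact_recovery_def
proof (intro conjI allI impI fin refl)
  fix c :: "real ^ 'd \<Rightarrow> real" and S'
  assume c: "\<forall>\<theta>\<in>S. c \<theta> \<noteq> 0"
  define y where "y = (\<Sum>\<theta>\<in>S. c \<theta> *\<^sub>R a \<theta>)"
  assume "omp_reachable_support a (\<Sum>\<theta>\<in>S. c \<theta> *\<^sub>R a \<theta>) S'"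
  then obtain ts where ts: "omp_run a y ts" "omp_resid a y ts = 0" "set ts = S'"
    unfolding omp_reachable_support_def y_def by blast
  have "y \<in> span (a ` S)" unfolding y_def by (intro span_sum span_scale span_base) auto
  then have sub: "S' \<subseteq> S" using omp_run_subset ts by blast
  have "y = orth_proj (a ` S') y" using ts(2,3) unfolding omp_resid_def by simp
  then have "y \<in> span (a ` S')" using orth_proj_in_span[of "a ` S'" y] ts(3) by auto
  then obtain b where b: "y = (\<Sum>j\<in>S'. b j *\<^sub>R a j)"
    using span_image_sum finite_subset[OF sub fin] by blast
  \<comment> \<open>Extension by zero brings both representations of \<open>y\<close> to the index
    set \<open>S\<close>.\<close>
  define b' where "b' j = (if j \<in> S' then b j else 0)" for j
  have "y = (\<Sum>j\<in>S. b' j *\<^sub>R a j)"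
    unfolding b b'_def using sub by (intro sum.mono_neutral_cong_left fin) auto
  then have "(\<Sum>j\<in>S. (c j - b' j) *\<^sub>R a j) = 0"
    unfolding scaleR_left_diff_distrib sum_subtractf by (simp flip: y_def)
  then have "c j - b' j = 0" if "j \<in> S" for j using independent_atoms[of "\<lambda>j. c j - b' j"] that by simp
  then have "S \<subseteq> S'" using c unfolding b'_def by (force split: if_splits)
  then show "S' = S" using sub by simp
qed

end

section \<open>From \<open>Delta0\<close> to a real separation, and the theorem\<close>

text \<open>A finite set has finitely many coordinate gaps, so \<open>Delta0\<close>, unless
  infinite, is attained; it is then positive and serves as \<open>\<Delta>\<close>.\<close>

lemma Delta0_separation:
  fixes S :: "(real ^ 'd) set"
  assumes fin: "finite S" and lam: "0 < lam"
    and sep: "Delta0 S = \<infinity> \<or> real_of_ereal (Delta0 S) powr p \<ge> ln (2 * real (card S) - 1) / lam"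
  obtains \<Delta> where "0 < \<Delta>"
    and "\<And>d x y. x \<in> S \<Longrightarrow> y \<in> S \<Longrightarrow> x $ d \<noteq> y $ d \<Longrightarrow> \<Delta> \<le> \<bar>x $ d - y $ d\<bar>"
    and "(2 * real (card S) - 1) * exp (- lam * \<Delta> powr p) \<le> 1"
proof -
  define E where "E = {ereal \<bar>x $ d - y $ d\<bar> | d x y. x \<in> S \<and> y \<in> S \<and> x $ d \<noteq> y $ d}"
  have D: "Delta0 S = Inf E" unfolding Delta0_def E_def ..
  have lower: "Delta0 S \<le> ereal \<bar>x $ d - y $ d\<bar>" if "x \<in> S" "y \<in> S" "x $ d \<noteq> y $ d" for x y d
  proof -
    have "ereal \<bar>x $ d - y $ d\<bar> \<in> E" unfolding E_def mem_Collect_eq using that by (intro exI conjI) auto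
    then show ?thesis unfolding D by (rule Inf_lower)
  qed
  show ?thesis
  proof (cases "Delta0 S = \<infinity>")
    \<comment> \<open>No two points differ in any coordinate, so \<open>S\<close> has at most one
      point and \<open>2 * card S - 1\<close> is at most 1; the choice \<open>\<Delta> = 1\<close>
      is arbitrary.\<close>
    case True
    have eq: "x $ d = y $ d" if "x \<in> S" "y \<in> S" for x y d
    proof (rule ccontr)
      assume "x $ d \<noteq> y $ d"
      then show False using lower[OF that] unfolding True by simp
    qed
    then have "\<And>x y. x \<in> S \<Longrightarrow> y \<in> S \<Longrightarrow> x = y" unfolding vec_eq_iff by blast
    then have "card S \<le> Suc 0" using card_le_Suc0_iff_eq[OF fin] by blast
    then have "(2 * real (card S) - 1) * exp (- lam * 1 powr p) \<le> 1 * 1"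
      using lam by (intro mult_mono) auto
    then have "(2 * real (card S) - 1) * exp (- lam * 1 powr p) \<le> 1" by simp
    then show ?thesis using eq by (intro that[of 1]) (blast | simp only: zero_less_one)+
  next
    case False
    then have "E \<noteq> {}" unfolding D by (auto simp: top_ereal_def)
    moreover have "E \<subseteq> (\<lambda>(d, x, y). ereal \<bar>x $ d - y $ d\<bar>) ` (UNIV \<times> S \<times> S)"
      unfolding E_def by force
    then have "finite E" by (rule finite_subset) (use fin in auto)
    ultimately have "Delta0 S \<in> E" unfolding D by (metis Min_Inf Min_in)
    then obtain d x y where xy: "Delta0 S = ereal \<bar>x $ d - y $ d\<bar>" "x \<in> S" "y \<in> S" "x $ d \<noteq> y $ d"
      unfolding E_def by blast
    define \<Delta> where "\<Delta> = \<bar>x $ d - y $ d\<bar>"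
    have "1 \<le> real (card S)" using fin xy(2) by (cases "card S") auto
    then have k: "0 < 2 * real (card S) - 1" by simp
    have "ln (2 * real (card S) - 1) \<le> lam * \<Delta> powr p"
      using sep False lam unfolding xy(1) \<Delta>_def by (simp add: field_simps)
    then have "2 * real (card S) - 1 \<le> exp (lam * \<Delta> powr p)" using k by (metis exp_le_cancel_iff exp_ln)
    then have "(2 * real (card S) - 1) * exp (- lam * \<Delta> powr p) \<le> 1"
      by (simp add: exp_minus field_simps)
    moreover have "\<Delta> \<le> \<bar>x' $ e - y' $ e\<bar>" if "x' \<in> S" "y' \<in> S" "x' $ e \<noteq> y' $ e" for x' y' e
      using lower[OF that] unfolding xy(1) \<Delta>_def by simp
    ultimately show ?thesis using xy(4) by (intro that[of \<Delta>]) (auto simp: \<Delta>_def)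
  qed
qed

theorem theorem5:
  fixes a :: "real ^ 'd \<Rightarrow> 'h :: {real_inner, complete_space}"
    and lam p :: real
    and Sstar :: "(real ^ 'd) set"
  assumes kernel: "\<And>\<theta> \<theta>'. a \<theta> \<bullet> a \<theta>' = exp (- lam * lp_pow p (\<theta> - \<theta>'))"
    and lam_pos: "lam > 0"
    and p: "0 < p" "p \<le> 1"
    and fin: "finite Sstar"
    and sep: "Delta0 Sstar = \<infinity> \<or>
              real_of_ereal (Delta0 Sstar) powr p \<ge> ln (2 * real (card Sstar) - 1) / lam"
  shows "\<forall>S. S \<subseteq> Sstar \<longrightarrow> omp_exact_recovery a (card S) S"
proof (intro allI impI)
  fix S assume S: "S \<subseteq> Sstar"
  obtain \<Delta> where \<Delta>: "0 < \<Delta>"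
    "\<And>d x y. x \<in> Sstar \<Longrightarrow> y \<in> Sstar \<Longrightarrow> x $ d \<noteq> y $ d \<Longrightarrow> \<Delta> \<le> \<bar>x $ d - y $ d\<bar>"
    "(2 * real (card Sstar) - 1) * exp (- lam * \<Delta> powr p) \<le> 1"
    using Delta0_separation[OF fin lam_pos sep] by metis
  \<comment> \<open>One \<open>\<Delta>\<close> serves all \<open>S\<close>: gaps pass to subsets,
    and the dominance condition is monotone in the cardinality.\<close>
  interpret separated_support a lam p \<Delta> S
  proof
    have "real (card S) \<le> real (card Sstar)" using S fin by (simp add: card_mono)
    then have "(2 * real (card S) - 1) * exp (- lam * \<Delta> powr p)
        \<le> (2 * real (card Sstar) - 1) * exp (- lam * \<Delta> powr p)"
      by (intro mult_right_mono) auto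
    then show "(2 * real (card S) - 1) * exp (- lam * \<Delta> powr p) \<le> 1" using \<Delta>(3) by linarith
    show "\<Delta> \<le> \<bar>x $ d - y $ d\<bar>" if "x \<in> S" "y \<in> S" "x $ d \<noteq> y $ d" for d x y
      using that S by (intro \<Delta>(2)) auto
  qed (use kernel lam_pos p finite_subset[OF S fin] \<Delta>(1) in auto)
  show "omp_exact_recovery a (card S) S" by (rule exact_recovery)
qed

end
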